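(* The time semi-discrete scheme (modified mid-point rule) $\mathcal S_{\Delta t}$ described in the context is reversible. That is, exchanging the unknowns at time $t^n$ with those at time $t^{n+1}$ and replacing $\Delta t$ by $-\Delta t$ gives the same scheme: $(f^n,\boldsymbol B^n,p^n)$ and $(f^{n+1},\boldsymbol B^{n+1},p^{n+1})$ are related by $\mathcal S_{\Delta t}$ (as old and new states, respectively) if and only if $(f^{n+1},\boldsymbol B^{n+1},p^{n+1})$ and $(f^{n},\boldsymbol B^{n},p^{n})$ are related by $\mathcal S_{-\Delta t}$ (as old and new states, respectively).
   Context: Unknowns: $f(\boldsymbol x,\boldsymbol v)$ (ion distribution function), $\boldsymbol B(\boldsymbol x)\in\mathbb R^3$ (magnetic field), $p(\boldsymbol x)$ (electron pressure), with $\boldsymbol x$ in a three-dimensional periodic box and $\boldsymbol v\in\mathbb R^3$; $\gamma\neq 1$ is a constant. All functions are assumed sufficiently smooth, $f$ decays sufficiently fast in $\boldsymbol v$ for the moments below to make sense, and $\rho=\int f\,\mathrm d\boldsymbol v>0$. For a field $a$ write $a^{n+\frac12}=\frac12(a^n+a^{n+1})$. The mean velocity is $\boldsymbol u^n=\frac1\rho\int \boldsymbol v f^n\,\mathrm d\boldsymbol v$. Scheme $\mathcal S_{h}$ with step $h\neq 0$ (where $t^{n+1}=t^n+h$; for $h<0$ time intervals are traversed backwards). The old state $(f^n,\boldsymbol B^n,p^n)$ and the new state $(f^{n+1},\boldsymbol B^{n+1},p^{n+1})$ are related by $\mathcal S_h$ if, with $\rho=\int f^n\,\mathrm d\boldsymbol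 v$ (which does not change during the step) and a vector field $\bar{\boldsymbol u}(\boldsymbol x)$: (i) $f^{n+1}(\boldsymbol x,\boldsymbol v)=f^n(\boldsymbol x,\boldsymbol v^n)$, where $\boldsymbol v^n$ is the value at time $t^n$ of the solution $\boldsymbol v(t)$, with $\boldsymbol v(t^{n+1})=\boldsymbol v$, of $$\dot{\boldsymbol v}=\Big(\boldsymbol v-\bar{\boldsymbol u}+\frac{\nabla\times\boldsymbol B^{n+\frac12}}{\rho}\Big)\times\boldsymbol B^{n+\frac12}-\frac{\nabla p^{n+\frac12}}{\rho}$$ (all fields evaluated at the fixed point $\boldsymbol x$); (ii) $\displaystyle \frac{\boldsymbol B^{n+1}-\boldsymbol B^n}{h}=\nabla\times\big(\bar{\boldsymbol u}\times\boldsymbol B^{n+\frac12}\big)-\nabla\times\Big(\frac{\nabla\times\boldsymbol B^{n+\frac12}}{\rho}\times\boldsymbol B^{n+\frac12}\Big)+\nabla\times\frac{\nabla p^{n+\frac12}}{\rho}$; (iii) $\displaystyle \frac{p^{n+1}-p^n}{h}+\nabla\cdot\big(p^{n+\frac12}\bar{\boldsymbol u}_e\big)+(\gamma-1)p^{n+\frac12}\,\nabla\cdot\bar{\boldsymbol u}_e=0$, with $\bar{\boldsymbol u}_e=\bar{\boldsymbol u}-\frac{\nabla\times\boldsymbol B^{n+\frac12}}{\rho}$; (iv) $\bar{\boldsymbol u}=\frac1{h}\int_{t^n}^{t^{n+1}}\boldsymbol u(t)\,\mathrm dt$, where $\boldsymbol u(t)$ solves, at each $\boldsymbol x$, $$\frac{\partial\boldsymbol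 u}{\partial t}=\Big(\boldsymbol u-\bar{\boldsymbol u}+\frac{\nabla\times\boldsymbol B^{n+\frac12}}{\rho}\Big)\times\boldsymbol B^{n+\frac12}-\frac{\nabla p^{n+\frac12}}{\rho},\qquad \boldsymbol u(t^n)=\boldsymbol u^n .$$ *)

theory Defs
  imports "HOL-Analysis.Analysis"
begin

type_synonym scalar_field = "real^3 \<Rightarrow> real"
type_synonym vector_field = "real^3 \<Rightarrow> real^3"

text \<open>A distribution function takes the position first and the velocity second.\<close>

type_synonym distribution = "real^3 \<Rightarrow> real^3 \<Rightarrow> real"

text \<open>\<open>(f, B, p)\<close>: ion distribution, magnetic field, electron pressure.\<close>

type_synonym state = "distribution \<times> vector_field \<times> scalar_field"

section \<open>Regularity and differential operators\<close>

text \<open>\<open>C\<^sup>k\<close> on the whole space.  In finite dimension, continuity of the derivative is the same as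
  continuity of all directional derivatives \<open>\<lambda>x. Dg(x) e\<close>.\<close>

fun Ck :: "nat \<Rightarrow> ('a::euclidean_space \<Rightarrow> 'b::real_normed_vector) \<Rightarrow> bool" where
  "Ck 0 g \<longleftrightarrow> continuous_on UNIV g"
| "Ck (Suc k) g \<longleftrightarrow>
     (\<forall>x. g differentiable (at x)) \<and> (\<forall>e. Ck k (\<lambda>x. frechet_derivative g (at x) e))"

text \<open>Functions on the periodic box with side lengths \<open>L $ i\<close> are periodic functions on the whole
  space.\<close>

definition box_periodic :: "real^3 \<Rightarrow> (real^3 \<Rightarrow> 'b) \<Rightarrow> bool" where
  "box_periodic L g \<longleftrightarrow> (\<forall>x i. g (x + axis i (L $ i)) = g x)"

definition partial :: "3 \<Rightarrow> (real^3 \<Rightarrow> 'b::real_normed_vector) \<Rightarrow> real^3 \<Rightarrow> 'b" where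
  "partial i g x = frechet_derivative g (at x) (axis i 1)"

definition grad :: "scalar_field \<Rightarrow> vector_field" where
  "grad p x = (\<chi> i. partial i p x)"

definition divg :: "vector_field \<Rightarrow> scalar_field" where
  "divg F x = (\<Sum>i\<in>UNIV. partial i F x $ i)"

definition curl :: "vector_field \<Rightarrow> vector_field" where
  "curl F x = vector [partial 2 F x $ 3 - partial 3 F x $ 2,
                      partial 3 F x $ 1 - partial 1 F x $ 3,
                      partial 1 F x $ 2 - partial 2 F x $ 1]"

section \<open>Moments and admissible states\<close>

definition density :: "distribution \<Rightarrow> scalar_field" where
  "density f x = (\<integral>v. f x v \<partial>lborel)"

definition mean_velocity :: "distribution \<Rightarrow> vector_field" where
  "mean_velocity f x = (1 / density f x) *\<^sub>R (\<integral>v. f x v *\<^sub>R v \<partial>lborel)"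

text \<open>The standing assumptions on the unknowns at one time level.  ``Sufficiently smooth'' is read as
  the least regularity for which every derivative in the scheme is a classical continuous one, and
  ``sufficiently fast decay'' as integrability of the two moments that the scheme uses.\<close>

fun admissible :: "real^3 \<Rightarrow> state \<Rightarrow> bool" where
  "admissible L (f, B, p) \<longleftrightarrow>
     (\<forall>v. box_periodic L (\<lambda>x. f x v)) \<and> box_periodic L B \<and> box_periodic L p \<and>
     Ck 1 (\<lambda>(x, v). f x v) \<and> Ck 1 (density f) \<and> Ck 2 B \<and> Ck 2 p \<and>
     (\<forall>x. integrable lborel (\<lambda>v. f x v)) \<and>
     (\<forall>x. integrable lborel (\<lambda>v. f x v *\<^sub>R v)) \<and>
     (\<forall>x. density f x > 0)"

section \<open>The scheme\<close>

definition half_step :: "('a \<Rightarrow> 'b::real_vector) \<Rightarrow> ('a \<Rightarrow> 'b) \<Rightarrow> 'a \<Rightarrow> 'b" where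
  "half_step a0 a1 x = (1 / 2) *\<^sub>R (a0 x + a1 x)"

text \<open>The right-hand side common to the equations for \<open>v(t)\<close> and \<open>u(t)\<close>, at a fixed position \<open>x\<close>.\<close>

definition accel ::
  "scalar_field \<Rightarrow> vector_field \<Rightarrow> vector_field \<Rightarrow> scalar_field \<Rightarrow> real^3 \<Rightarrow> real^3 \<Rightarrow> real^3" where
  "accel \<rho> ubar B p x w =
     cross3 (w - ubar x + (1 / \<rho> x) *\<^sub>R curl B x) (B x) - (1 / \<rho> x) *\<^sub>R grad p x"

text \<open>Since \<open>h\<close> may be negative, the time interval between \<open>t\<close> and \<open>t + h\<close> is a \<^const>\<open>closed_segment\<close>.\<close>

definition solves_between ::
  "real \<Rightarrow> real \<Rightarrow> (real \<Rightarrow> real^3) \<Rightarrow> (real^3 \<Rightarrow> real^3) \<Rightarrow> bool" where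
  "solves_between t h w F \<longleftrightarrow>
     (\<forall>s\<in>closed_segment t (t + h).
        (w has_vector_derivative F (w s)) (at s within closed_segment t (t + h)))"

text \<open>One step of size \<open>h\<close> from time \<open>t\<close> to time \<open>t + h\<close>; the last four conjuncts are the transport of
  \<open>f\<close> along the velocity characteristics, the induction equation, the pressure equation and the
  equation for the time-averaged mean velocity.  The interval integral is oriented: it changes sign
  when its end points are exchanged.\<close>

fun scheme :: "real^3 \<Rightarrow> real \<Rightarrow> real \<Rightarrow> real \<Rightarrow> state \<Rightarrow> state \<Rightarrow> bool" where
  "scheme L \<gamma> t h (f0, B0, p0) (f1, B1, p1) \<longleftrightarrow>
    (let \<rho> = density f0; Bm = half_step B0 B1; pm = half_step p0 p1 in
     \<exists>ubar :: vector_field.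
       box_periodic L ubar \<and> Ck 1 ubar \<and>
       (\<forall>x v. \<exists>w. solves_between t h w (accel \<rho> ubar Bm pm x) \<and> w (t + h) = v \<and>
          f1 x v = f0 x (w t)) \<and>
       (\<forall>x. (1 / h) *\<^sub>R (B1 x - B0 x) =
          curl (\<lambda>y. cross3 (ubar y) (Bm y)) x
          - curl (\<lambda>y. cross3 ((1 / \<rho> y) *\<^sub>R curl Bm y) (Bm y)) x
          + curl (\<lambda>y. (1 / \<rho> y) *\<^sub>R grad pm y) x) \<and>
       (let ue = (\<lambda>x. ubar x - (1 / \<rho> x) *\<^sub>R curl Bm x) in
        \<forall>x. (p1 x - p0 x) / h + divg (\<lambda>y. pm y *\<^sub>R ue y) x + (\<gamma> - 1) * pm x * divg ue x = 0) \<and>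
       (\<forall>x. \<exists>u. solves_between t h u (accel \<rho> ubar Bm pm x) \<and> u t = mean_velocity f0 x \<and>
          ubar x = (1 / h) *\<^sub>R (LBINT s=ereal t..ereal (t + h). u s)))"

end

theory Submission
  imports Defs
begin

text \<open>
  The scheme is symmetric by design: the field equations only see \<open>h\<close> through difference quotients
  that are invariant under exchanging the two time levels together with the sign of \<open>h\<close>, and through
  half-step averages that do not distinguish the levels.  The same \<open>ubar\<close> therefore serves both
  directions, and an ODE solution on the time interval is the same object in either orientation.  Three
  points need an argument: the transport of \<open>f\<close> must be invertible, the density in the reversed scheme
  must be the original one, and the solution \<open>u\<close> that starts at the old mean velocity must end at the
  new one.

  All three come from one fact.  At a fixed position the velocity equation reads
  \<open>w' = (w + c) \<times> b + d\<close> with constant vectors, so the difference \<open>e\<close> of two solutions satisfies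
  \<open>e' = e \<times> b\<close>, which is orthogonal to \<open>e\<close>: distances between solutions are constant
  (\<open>dist_solutions_constant\<close>).  Hence solutions are determined by their value at either end, and the map
  \<open>\<Phi>\<close> from final to initial velocities is an isometry of the velocity space
  (\<open>skew_flow_isometry\<close>).  An isometry of a Euclidean space is an orthogonal map followed by a
  translation.  It is therefore surjective, so a solution exists for every \<^emph>\<open>initial\<close> velocity as well;
  it preserves Lebesgue measure, so \<open>f1 = f0 \<circ> \<Phi>\<close> has the density of \<open>f0\<close>; and it is affine, so it
  commutes with averaging and sends the mean velocity of \<open>f1\<close> to that of \<open>f0\<close>
  (\<open>moments_transported_by_isometry\<close>).  Since \<open>u\<close> obeys the same equation as the characteristics,
  \<open>\<Phi>\<close> also sends \<open>u (t + h)\<close> to \<open>u t\<close>, and injectivity identifies \<open>u (t + h)\<close> with the new mean velocity.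
\<close>

section \<open>The velocity flow\<close>

lemma solves_between_reverse:
  "solves_between (t + h) (- h) w F \<longleftrightarrow> solves_between t h w F"
  by (simp add: solves_between_def closed_segment_commute)

text \<open>Skewness of \<open>F\<close> makes the derivative of the squared distance vanish.  The conclusion contains
  uniqueness, in both time directions.\<close>

lemma dist_solutions_constant:
  assumes w1: "solves_between t h w1 F" and w2: "solves_between t h w2 F"
    and skew: "\<And>a b. (a - b) \<bullet> (F a - F b) = 0"
  shows "dist (w1 (t + h)) (w2 (t + h)) = dist (w1 t) (w2 t)"
proof -
  let ?S = "closed_segment t (t + h)"
  define g where "g s = (w1 s - w2 s) \<bullet> (w1 s - w2 s)" for s
  have "(g has_derivative (\<lambda>_. 0)) (at s within ?S)" if "s \<in> ?S" for s
  proof -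
    have d: "((\<lambda>s. w1 s - w2 s) has_derivative (\<lambda>r. r *\<^sub>R (F (w1 s) - F (w2 s)))) (at s within ?S)"
      using has_vector_derivative_diff[of w1 "F (w1 s)" "at s within ?S" w2 "F (w2 s)"] w1 w2 that
      by (simp add: solves_between_def has_vector_derivative_def)
    show ?thesis
      unfolding g_def
      by (rule has_derivative_eq_rhs[OF has_derivative_inner[OF d d]])
         (simp add: fun_eq_iff inner_commute[of "F _ - F _"] skew)
  qed
  then obtain c where "\<forall>s\<in>?S. g s = c"
    using has_derivative_zero_constant[OF convex_closed_segment] by blast
  then have "g (t + h) = g t"
    by simp
  then show ?thesis
    by (simp add: g_def dist_norm norm_eq_sqrt_inner)
qed

text \<open>The affine terms cancel in the difference, and what remains is a cross product, which is orthogonal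
  to its factor \<open>a - b\<close>.\<close>

lemma accel_skew:
  "(a - b) \<bullet> (accel \<rho> ubar B p x a - accel \<rho> ubar B p x b) = 0"
proof -
  have "accel \<rho> ubar B p x a - accel \<rho> ubar B p x b = cross3 (a - b) (B x)"
    by (simp add: accel_def cross3_simps)
  then show ?thesis
    by (simp add: dot_cross_self)
qed

text \<open>Existence of solutions is not proved but inherited: the transport equation provides one for every
  final velocity \<open>v\<close>.  The predicate \<open>P\<close> carries the equation for \<open>f\<close>, which the transport equation
  asserts only for some solution, over to the flow map \<open>\<Phi>\<close>, which describes all of them.\<close>

lemma skew_flow_isometry:
  fixes F :: "real^3 \<Rightarrow> real^3"
  assumes "\<And>v. \<exists>w. solves_between t h w F \<and> w (t + h) = v \<and> P v (w t)"
    and skew: "\<And>a b. (a - b) \<bullet> (F a - F b) = 0"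
  obtains \<Phi> where "\<And>w. solves_between t h w F \<Longrightarrow> w t = \<Phi> (w (t + h))"
    and "\<And>v. \<exists>w. solves_between t h w F \<and> w (t + h) = v"
    and "\<And>v. P v (\<Phi> v)"
    and "\<And>a b. dist (\<Phi> a) (\<Phi> b) = dist a b"
proof -
  obtain W where W: "\<And>v. solves_between t h (W v) F" "\<And>v. W v (t + h) = v" "\<And>v. P v (W v t)"
    using assms(1) by metis
  have "w t = W (w (t + h)) t" if "solves_between t h w F" for w
    using dist_solutions_constant[OF that W(1)[of "w (t + h)"] skew] by (simp add: W(2))
  moreover have "dist (W a t) (W b t) = dist a b" for a b
    using dist_solutions_constant[OF W(1)[of a] W(1)[of b] skew] by (simp add: W(2))
  ultimately show ?thesis
    using that[of "\<lambda>v. W v t"] W by metis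
qed

section \<open>Isometries preserve Lebesgue measure\<close>

lemma isometry_eq_orthogonal_plus_translation:
  fixes \<Phi> :: "'a::real_inner \<Rightarrow> 'a"
  assumes "\<And>a b. dist (\<Phi> a) (\<Phi> b) = dist a b"
  obtains A where "orthogonal_transformation A" "\<Phi> = (\<lambda>v. \<Phi> 0 + A v)"
proof
  show "orthogonal_transformation (\<lambda>v. \<Phi> v - \<Phi> 0)"
    using assms by (simp add: orthogonal_transformation_isometry dist_norm)
qed auto

lemma isometry_imp_surj:
  fixes \<Phi> :: "'a::euclidean_space \<Rightarrow> 'a"
  assumes "\<And>a b. dist (\<Phi> a) (\<Phi> b) = dist a b"
  shows "surj \<Phi>"
proof -
  obtain A where A: "orthogonal_transformation A" "\<Phi> = (\<lambda>v. \<Phi> 0 + A v)"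
    using isometry_eq_orthogonal_plus_translation[OF assms] .
  have "\<exists>v. y = \<Phi> v" for y
    using orthogonal_transformation_surj[OF A(1)] by (subst A(2)) (metis surjD diff_add_cancel add.commute)
  then show ?thesis by (simp add: surj_def)
qed

lemma distr_lborel_orthogonal_transformation:
  fixes A :: "real^'n::{finite,wellorder} \<Rightarrow> real^'n::_"
  assumes "orthogonal_transformation A"
  shows "distr lborel borel A = lborel"
proof (rule lborel_eqI[symmetric])
  have [measurable]: "A \<in> borel_measurable borel"
    using assms by (intro borel_measurable_continuous_onI linear_continuous_on)
      (simp add: orthogonal_transformation_linear linear_conv_bounded_linear[symmetric])
  fix l u :: "real^'n::_"
  assume le: "\<And>b. b \<in> Basis \<Longrightarrow> l \<bullet> b \<le> u \<bullet> b"
  \<comment> \<open>The preimage of a box is its image under the inverse, which is again orthogonal.\<close>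
  have inv: "orthogonal_transformation (inv A)"
    using assms by (rule orthogonal_transformation_inv)
  have vim: "A -` box l u = inv A ` box l u"
    using orthogonal_transformation_bij[OF assms] by (rule bij_vimage_eq_inv_image)
  have m: "A -` box l u \<in> lmeasurable"
    unfolding vim by (rule measurable_orthogonal_image[OF inv]) simp
  have "A -` box l u \<in> sets borel"
    using measurable_sets[of A borel borel "box l u"] by simp
  then have "emeasure (distr lborel borel A) (box l u) = emeasure lebesgue (A -` box l u)"
    by (simp add: emeasure_distr)
  also have "\<dots> = measure lebesgue (inv A ` box l u)"
    using m by (simp add: emeasure_eq_measure2 vim)
  also have "\<dots> = measure lebesgue (box l u)"
    by (simp add: measure_orthogonal_image[OF inv])
  also have "\<dots> = (\<Prod>b\<in>Basis. (u - l) \<bullet> b)"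
    using le by (simp add: measure_lborel_box_eq)
  finally show "emeasure (distr lborel borel A) (box l u) = (\<Prod>b\<in>Basis. (u - l) \<bullet> b)" .
qed simp

lemma distr_lborel_isometry:
  fixes \<Phi> :: "real^'n::{finite,wellorder} \<Rightarrow> real^'n::_"
  assumes "\<And>a b. dist (\<Phi> a) (\<Phi> b) = dist a b"
  shows "distr lborel borel \<Phi> = lborel"
proof -
  obtain A where A: "orthogonal_transformation A" "\<Phi> = (\<lambda>v. \<Phi> 0 + A v)"
    using isometry_eq_orthogonal_plus_translation[OF assms] .
  have [measurable]: "A \<in> borel_measurable borel"
    using A(1) by (intro borel_measurable_continuous_onI linear_continuous_on)
      (simp add: orthogonal_transformation_linear linear_conv_bounded_linear[symmetric])
  have "distr lborel borel ((+) (\<Phi> 0) \<circ> A) = distr (distr lborel borel A) borel ((+) (\<Phi> 0))"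
    by (rule distr_distr[symmetric]) auto
  also have "\<dots> = lborel"
    by (simp only: distr_lborel_orthogonal_transformation[OF A(1)] lborel_distr_plus)
  also have "(+) (\<Phi> 0) \<circ> A = \<Phi>"
    by (subst A(2)) auto
  finally show ?thesis .
qed

section \<open>Reversal of one step\<close>

text \<open>Change of variables \<open>v \<mapsto> \<Phi> v\<close> in both moments of \<open>f0\<close>.  For the first moment, the affine
  form of \<open>\<Phi>\<close> allows it to be pulled out of the normalised integral of \<open>f1 x v *\<^sub>R \<Phi> v\<close>.\<close>

lemma moments_transported_by_isometry:
  fixes f0 f1 :: distribution
  assumes iso: "\<And>a b. dist (\<Phi> a) (\<Phi> b) = dist a b"
    and f1: "\<And>v. f1 x v = f0 x (\<Phi> v)"
    and int0: "integrable lborel (f0 x)" "integrable lborel (\<lambda>v. f0 x v *\<^sub>R v)"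
    and int1: "integrable lborel (f1 x)" "integrable lborel (\<lambda>v. f1 x v *\<^sub>R v)"
    and pos: "density f0 x > 0"
  shows "density f1 x = density f0 x"
    and "\<Phi> (mean_velocity f1 x) = mean_velocity f0 x"
proof -
  obtain A where A: "orthogonal_transformation A" "\<Phi> = (\<lambda>v. \<Phi> 0 + A v)"
    using isometry_eq_orthogonal_plus_translation[OF iso] .
  have bl: "bounded_linear A"
    using A(1) by (simp add: orthogonal_transformation_linear linear_conv_bounded_linear[symmetric])
  interpret A: bounded_linear A by (rule bl)
  have [measurable]: "\<Phi> \<in> borel_measurable borel"
    by (subst A(2)) (intro borel_measurable_continuous_onI continuous_intros linear_continuous_on bl)
  have change: "(\<integral>v. G (\<Phi> v) \<partial>lborel) = (\<integral>v. G v \<partial>lborel)"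
    if "integrable lborel G" for G :: "real^3 \<Rightarrow> 'b::{banach, second_countable_topology}"
    using integral_distr[of \<Phi> lborel borel G] borel_measurable_integrable[OF that]
    by (simp add: distr_lborel_isometry[OF iso])
  show dens: "density f1 x = density f0 x"
    using change[OF int0(1)] by (simp add: density_def f1)
  have "(\<integral>v. f0 x v *\<^sub>R v \<partial>lborel) = (\<integral>v. f0 x (\<Phi> v) *\<^sub>R \<Phi> v \<partial>lborel)"
    using change[OF int0(2)] by simp
  also have "\<dots> = (\<integral>v. f1 x v *\<^sub>R \<Phi> 0 + A (f1 x v *\<^sub>R v) \<partial>lborel)"
    by (subst (2) A(2)) (simp add: f1 scaleR_add_right A.scaleR)
  also have "\<dots> = density f1 x *\<^sub>R \<Phi> 0 + A (\<integral>v. f1 x v *\<^sub>R v \<partial>lborel)"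
    using int1 by (simp add: integral_bounded_linear[OF bl] integrable_bounded_linear[OF bl] density_def)
  finally have "mean_velocity f0 x = \<Phi> 0 + A (mean_velocity f1 x)"
    using pos by (simp add: mean_velocity_def dens scaleR_add_right A.scaleR)
  also have "\<dots> = \<Phi> (mean_velocity f1 x)"
    by (subst (2) A(2)) simp
  finally show "\<Phi> (mean_velocity f1 x) = mean_velocity f0 x" ..
qed

lemma half_step_commute: "half_step a b = half_step b a"
  by (simp add: half_step_def fun_eq_iff add.commute)

text \<open>The reversed scheme holds with the same \<open>ubar\<close>.  This implication, applied once more to the reversed
  data, is also its own converse.\<close>

lemma scheme_reverse:
  fixes f0 f1 :: distribution
  assumes adm0: "admissible L (f0, B0, p0)" and adm1: "admissible L (f1, B1, p1)"
    and scheme: "scheme L \<gamma> t h (f0, B0, p0) (f1, B1, p1)"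
  shows "scheme L \<gamma> (t + h) (- h) (f1, B1, p1) (f0, B0, p0)"
proof -
  define \<rho> Bm pm where "\<rho> = density f0" and "Bm = half_step B0 B1" and "pm = half_step p0 p1"
  note fields = \<rho>_def[symmetric] Bm_def[symmetric] pm_def[symmetric]
  obtain ubar where ubar: "box_periodic L ubar" "Ck 1 ubar"
    and transport: "\<And>x v. \<exists>w. solves_between t h w (accel \<rho> ubar Bm pm x) \<and> w (t + h) = v \<and>
          f1 x v = f0 x (w t)"
    and induction: "\<And>x. (1 / h) *\<^sub>R (B1 x - B0 x) =
          curl (\<lambda>y. cross3 (ubar y) (Bm y)) x
          - curl (\<lambda>y. cross3 ((1 / \<rho> y) *\<^sub>R curl Bm y) (Bm y)) x
          + curl (\<lambda>y. (1 / \<rho> y) *\<^sub>R grad pm y) x"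
    and pressure: "\<And>x. (p1 x - p0 x) / h
          + divg (\<lambda>y. pm y *\<^sub>R (ubar y - (1 / \<rho> y) *\<^sub>R curl Bm y)) x
          + (\<gamma> - 1) * pm x * divg (\<lambda>y. ubar y - (1 / \<rho> y) *\<^sub>R curl Bm y) x = 0"
    and velocity: "\<And>x. \<exists>u. solves_between t h u (accel \<rho> ubar Bm pm x) \<and>
          u t = mean_velocity f0 x \<and>
          ubar x = (1 / h) *\<^sub>R (LBINT s=ereal t..ereal (t + h). u s)"
    using scheme unfolding scheme.simps Let_def fields by blast
  have rev: "density f1 x = \<rho> x"
      "\<exists>w. solves_between t h w (accel \<rho> ubar Bm pm x) \<and> w t = v \<and> f0 x v = f1 x (w (t + h))"
      "\<exists>u. solves_between t h u (accel \<rho> ubar Bm pm x) \<and> u (t + h) = mean_velocity f1 x \<and>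
          ubar x = (1 / h) *\<^sub>R (LBINT s=ereal t..ereal (t + h). u s)" for x v
  proof -
    obtain \<Phi> where \<Phi>: "\<And>w. solves_between t h w (accel \<rho> ubar Bm pm x) \<Longrightarrow> w t = \<Phi> (w (t + h))"
      and ex: "\<And>v. \<exists>w. solves_between t h w (accel \<rho> ubar Bm pm x) \<and> w (t + h) = v"
      and f1: "\<And>v. f1 x v = f0 x (\<Phi> v)"
      and iso: "\<And>a b. dist (\<Phi> a) (\<Phi> b) = dist a b"
      using skew_flow_isometry[of t h "accel \<rho> ubar Bm pm x" "\<lambda>v z. f1 x v = f0 x z",
          OF transport accel_skew] by metis
    have ints: "integrable lborel (f0 x)" "integrable lborel (\<lambda>v. f0 x v *\<^sub>R v)"
        "integrable lborel (f1 x)" "integrable lborel (\<lambda>v. f1 x v *\<^sub>R v)" "density f0 x > 0"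
      using adm0 adm1 by auto
    note moments = moments_transported_by_isometry[where ?f0.0 = f0 and ?f1.0 = f1 and x = x,
        OF iso f1 ints]
    show "density f1 x = \<rho> x"
      by (simp add: moments \<rho>_def)
    \<comment> \<open>The solution through the initial velocity \<open>v\<close> is the one that ends at a preimage of \<open>v\<close>.\<close>
    obtain v' where "v = \<Phi> v'"
      using isometry_imp_surj[OF iso] by (metis surjD)
    with ex[of v'] \<Phi> f1
    show "\<exists>w. solves_between t h w (accel \<rho> ubar Bm pm x) \<and> w t = v \<and> f0 x v = f1 x (w (t + h))"
      by metis
    obtain u where u: "solves_between t h u (accel \<rho> ubar Bm pm x)" "u t = mean_velocity f0 x"
      "ubar x = (1 / h) *\<^sub>R (LBINT s=ereal t..ereal (t + h). u s)"
      using velocity by blast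
    have "\<Phi> (u (t + h)) = \<Phi> (mean_velocity f1 x)"
      using \<Phi>[OF u(1)] u(2) moments(2) by simp
    then have "u (t + h) = mean_velocity f1 x"
      using iso by (metis dist_eq_0_iff)
    with u show "\<exists>u. solves_between t h u (accel \<rho> ubar Bm pm x) \<and> u (t + h) = mean_velocity f1 x \<and>
          ubar x = (1 / h) *\<^sub>R (LBINT s=ereal t..ereal (t + h). u s)"
      by blast
  qed
  have dens: "density f1 = \<rho>"
    using rev(1) by blast
  have "(1 / - h) *\<^sub>R (B0 x - B1 x) = (1 / h) *\<^sub>R (B1 x - B0 x)"
    and "(p0 x - p1 x) / - h = (p1 x - p0 x) / h" for x
    by (simp_all add: scaleR_diff_right diff_divide_distrib)
  \<comment> \<open>The sign of \<open>h\<close> in the time average cancels the orientation of the integral.\<close>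
  moreover have "(1 / - h) *\<^sub>R (LBINT s=ereal (t + h)..ereal t. u s)
      = (1 / h) *\<^sub>R (LBINT s=ereal t..ereal (t + h). u s)" for u :: "real \<Rightarrow> real^3"
    by (subst interval_integral_endpoints_reverse) simp
  ultimately show ?thesis
    unfolding scheme.simps Let_def dens half_step_commute[of B1] half_step_commute[of p1] fields
      solves_between_reverse add_uminus_conv_diff add_diff_cancel_right'
    using ubar rev(2,3) induction pressure
    by (intro exI[of _ ubar]) auto
qed

theorem theorem4p1:
  fixes L :: "real^3" and \<gamma> t h :: real
    and f0 f1 :: distribution and B0 B1 :: vector_field and p0 p1 :: scalar_field
  assumes "\<And>i. L $ i > 0" and "\<gamma> \<noteq> 1" and "h \<noteq> 0"
    and "admissible L (f0, B0, p0)" and "admissible L (f1, B1, p1)"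
  shows "scheme L \<gamma> t h (f0, B0, p0) (f1, B1, p1) \<longleftrightarrow>
         scheme L \<gamma> (t + h) (- h) (f1, B1, p1) (f0, B0, p0)"
proof
  assume "scheme L \<gamma> (t + h) (- h) (f1, B1, p1) (f0, B0, p0)"
  from scheme_reverse[OF assms(5,4) this]
  show "scheme L \<gamma> t h (f0, B0, p0) (f1, B1, p1)"
    by simp
qed (rule scheme_reverse[OF assms(4,5)])

end
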